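(* Consider the estimation dynamics $\dot{\hat{\mathbf{z}}}(t)=H\hat{\mathbf{z}}(t)$, $\hat{\mathbf{z}}(t)\in\mathbb{C}^M$, with $H$ and $\mathbf{z}$ as in the context, and let $\mathscr{E}=\mathrm{span}(\mathbf{z})$ and $\mathscr{D}=\mathscr{E}\setminus\{\mathbf{0}\}$. There exists a finite point $\mathbf{z}_\infty\in\mathscr{E}$ to which $\hat{\mathbf{z}}(t)$ converges exponentially (i.e. there are constants $\tau,\sigma>0$ with $\|\hat{\mathbf{z}}(t)-\mathbf{z}_\infty\|\le\tau e^{-\sigma(t-t_0)}\|\hat{\mathbf{z}}(t_0)-\mathbf{z}_\infty\|$ for all $t\ge t_0$) if and only if the edge localization graph $\bar{\mathcal{G}}$ has an oriented spanning tree. Furthermore, $\mathbf{z}_\infty\in\mathscr{D}$ if and only if the initial estimate $\hat{\mathbf{z}}(t_0)$ is not in the column space $\mathrm{C}(H)$ of $H$.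
   Context: Setting. There are $N$ agents $\mathcal{V}=\{1,\dots,N\}$ at distinct positions $\mathbf{p}_u\in\mathbb{R}^2$. The bearing vector is $\mathbf{g}_{vu}=(\mathbf{p}_v-\mathbf{p}_u)/\|\mathbf{p}_v-\mathbf{p}_u\|$ and $\angle\mathbf{g}_{vu}\in[-\pi,\pi)$ its angle in a fixed global frame. For distinct agents $u,v,w$, $\alpha^{u}_{wv}\in[-\pi,\pi)$ denotes the counterclockwise angle at $u$ from $\mathbf{g}_{vu}$ to $\mathbf{g}_{wu}$. A set $\mathcal{S}$ of measured subtended angles is given, with $\alpha^{u}_{wv}\in\mathcal{S}$ iff $\alpha^{u}_{vw}\in\mathcal{S}$. Standing assumption: if an agent measures subtended angles between two or more pairs of other agents, all bearing vectors associated with these measurements are related to each other through them (so that the subtended angle at that agent between any two of these agents is determined by its measurements). The communication graph $\mathcal{G}=(\mathcal{V},\mathcal{E})$ has as edges exactly the ordered pairs $(u,v),(v,u),(u,w),(w,u)$ for all $\alpha^{u}_{wv}\in\mathcal{S}$; it is symmetric and assumed connected. Edge localization graph $\bar{\mathcal{G}}=(\bar{\mathcal{V}},\bar{\mathcal{E}})$: for each $(u,v)\in\mathcal{E}$ with no $w$ such that $\alpha^{v}_{wu}\in\mathcal{S}$, introduce a new virtual vertex $\bar v^{u}$ (distinct for distinct such pairs), co-located with agent $v$; $\bar{\mathcal{E}}$ is obtained from $\mathcal{E}$ by replacing each such pair $(u,v),(v,u)$ by $(u,\bar v^{u}),(\bar v^{u},u)$; $\bar{\mathcal{V}}$ consists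 of the agents that measure at least one subtended angle together with all virtual vertices. For $a\in\bar{\mathcal{V}}$ let $\rho(a)$ be the real agent it is (co-located with): $\rho(\bar v^u)=v$, $\rho(v)=v$. The directed line graph $L(\bar{\mathcal{G}})$ has vertex set $\bar{\mathcal{E}}$ and an edge $(e_1,e_2)$ whenever the head of $e_1$ equals the tail of $e_2$. The localization interaction graph $\mathcal{G}'=(\mathcal{V}',\mathcal{E}')$ is $L(\bar{\mathcal{G}})$ with vertices relabelled by a bijection onto $\mathcal{V}'=\{1,\dots,M\}$, $M=|\bar{\mathcal{E}}|$; vertex $k$ corresponding to $(a,b)\in\bar{\mathcal{E}}$ is the edge agent $k$; its neighbor set is $\mathcal{N}_k=\{j:(k,j)\in\mathcal{E}'\}$. For edge agent $k$ corresponding to $(a,b)$ set $\theta_k=\angle\mathbf{g}_{\rho(b)\rho(a)}$ and $z_k=e^{\mathrm{i}\theta_k}$, $\mathbf{z}=[z_1,\dots,z_M]^T$. For $j\in\mathcal{N}_k$ with $j$ corresponding to $(b,c)$, write $u=\rho(a)$, $v=\rho(b)$, $w=\rho(c)$ and set $\theta_{jk}=\mathrm{PV}(\alpha^{v}_{wu}+\pi)$ if $w\neq u$ and $\theta_{jk}=-\pi$ if $w=u$, where $\mathrm{PV}(\theta)=[(\theta+\pi)\bmod 2\pi]-\pi$. The matrix $H$ has entries $[H]_{kk}=-|\mathcal{N}_k|$, $[H]_{kj}=e^{-\mathrm{i}\theta_{jk}}$ if $j\in\mathcal{N}_k$, and $0$ otherwise; equivalently $\dot{\hat z}_k=\sum_{j\in\mathcal{N}_k}(e^{-\mathrm{i}\theta_{jk}}\hat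 z_j-\hat z_k)$. An oriented spanning tree of a directed graph with root $r$ is an acyclic subgraph containing all vertices in which every vertex other than $r$ has a directed path to $r$. *)

theory Defs
  imports "HOL-Analysis.Analysis"
begin

text \<open>Principal value: PV(theta) = ((theta + pi) mod 2 pi) - pi, in [-pi, pi).\<close>
definition PV :: "real \<Rightarrow> real" where
  "PV \<theta> = \<theta> - 2 * pi * of_int \<lfloor>(\<theta> + pi) / (2 * pi)\<rfloor>"

text \<open>Positions in R^2 are represented as complex numbers. bearing p v u is g_vu.\<close>
definition bearing :: "(nat \<Rightarrow> complex) \<Rightarrow> nat \<Rightarrow> nat \<Rightarrow> complex" where
  "bearing p v u = (p v - p u) / complex_of_real (cmod (p v - p u))"

text \<open>Angle of g_vu in the global frame, taken in [-pi, pi).\<close>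
definition bangle :: "(nat \<Rightarrow> complex) \<Rightarrow> nat \<Rightarrow> nat \<Rightarrow> real" where
  "bangle p v u = PV (Arg (bearing p v u))"

text \<open>subangle p u w v is alpha^u_{wv}: the counterclockwise angle at u from g_vu to g_wu,
  in [-pi, pi).\<close>
definition subangle :: "(nat \<Rightarrow> complex) \<Rightarrow> nat \<Rightarrow> nat \<Rightarrow> nat \<Rightarrow> real" where
  "subangle p u w v = PV (bangle p w u - bangle p v u)"

text \<open>The set S of measured subtended angles is a set of triples; (u,w,v) in S
  encodes that alpha^u_{wv} is in S.\<close>

definition commE :: "(nat \<times> nat \<times> nat) set \<Rightarrow> (nat \<times> nat) set" where
  "commE S = {e. \<exists>u w v. (u, w, v) \<in> S \<and> e \<in> {(u, v), (v, u), (u, w), (w, u)}}"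

text \<open>meas_with S v u: there is w with alpha^v_{wu} in S.\<close>
definition meas_with :: "(nat \<times> nat \<times> nat) set \<Rightarrow> nat \<Rightarrow> nat \<Rightarrow> bool" where
  "meas_with S v u = (\<exists>w. (v, w, u) \<in> S)"

definition measures :: "(nat \<times> nat \<times> nat) set \<Rightarrow> nat \<Rightarrow> bool" where
  "measures S v = (\<exists>w u. (v, w, u) \<in> S)"

text \<open>Vertices of the edge localization graph: Ag v is the agent v,
  Vir u v is the virtual vertex bar v^u (co-located with v).\<close>
datatype vtx = Ag nat | Vir nat nat

fun rho :: "vtx \<Rightarrow> nat" where
  "rho (Ag v) = v"
| "rho (Vir u v) = v"

definition Ebar :: "(nat \<times> nat \<times> nat) set \<Rightarrow> (vtx \<times> vtx) set" where
  "Ebar S =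
     {(Ag u, Ag v) | u v. (u, v) \<in> commE S \<and> meas_with S v u \<and> meas_with S u v}
   \<union> {(Ag u, Vir u v) | u v. (u, v) \<in> commE S \<and> \<not> meas_with S v u}
   \<union> {(Vir u v, Ag u) | u v. (u, v) \<in> commE S \<and> \<not> meas_with S v u}"

definition Vbar :: "(nat \<times> nat \<times> nat) set \<Rightarrow> vtx set" where
  "Vbar S = {Ag v | v. measures S v}
          \<union> {Vir u v | u v. (u, v) \<in> commE S \<and> \<not> meas_with S v u}"

text \<open>Oriented spanning tree of the directed graph (V, E) with root r.\<close>
definition is_oriented_spanning_tree :: "'a set \<Rightarrow> ('a \<times> 'a) set \<Rightarrow> 'a \<Rightarrow> ('a \<times> 'a) set \<Rightarrow> bool" where
  "is_oriented_spanning_tree V E r T \<longleftrightarrow>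
     r \<in> V \<and> T \<subseteq> E \<and> acyclic T \<and> (\<forall>v\<in>V. v \<noteq> r \<longrightarrow> (v, r) \<in> T\<^sup>+)"

definition has_oriented_spanning_tree :: "'a set \<Rightarrow> ('a \<times> 'a) set \<Rightarrow> bool" where
  "has_oriented_spanning_tree V E \<longleftrightarrow> (\<exists>r T. is_oriented_spanning_tree V E r T)"

text \<open>Edge agents: lab is the bijection from the index type onto Ebar
  (edge agent k corresponds to the edge lab k = (a,b)).\<close>

definition nbrs :: "('m \<Rightarrow> vtx \<times> vtx) \<Rightarrow> 'm \<Rightarrow> 'm set" where
  "nbrs lab k = {j. fst (lab j) = snd (lab k)}"

definition theta :: "(nat \<Rightarrow> complex) \<Rightarrow> ('m \<Rightarrow> vtx \<times> vtx) \<Rightarrow> 'm \<Rightarrow> real" where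
  "theta p lab k = bangle p (rho (snd (lab k))) (rho (fst (lab k)))"

definition zvec :: "(nat \<Rightarrow> complex) \<Rightarrow> ('m::finite \<Rightarrow> vtx \<times> vtx) \<Rightarrow> complex ^ 'm" where
  "zvec p lab = (\<chi> k. cis (theta p lab k))"

text \<open>theta_rel p lab j k is theta_{jk}, for j in nbrs lab k.\<close>
definition theta_rel :: "(nat \<Rightarrow> complex) \<Rightarrow> ('m \<Rightarrow> vtx \<times> vtx) \<Rightarrow> 'm \<Rightarrow> 'm \<Rightarrow> real" where
  "theta_rel p lab j k =
     (let u = rho (fst (lab k)); v = rho (snd (lab k)); w = rho (snd (lab j))
      in if w \<noteq> u then PV (subangle p v w u + pi) else - pi)"

definition Hmat :: "(nat \<Rightarrow> complex) \<Rightarrow> ('m::finite \<Rightarrow> vtx \<times> vtx) \<Rightarrow> complex ^ 'm ^ 'm" where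
  "Hmat p lab = (\<chi> k j. if j = k then - of_nat (card (nbrs lab k))
                        else if j \<in> nbrs lab k then cis (- theta_rel p lab j k) else 0)"

text \<open>zh solves d/dt zh = H zh for t \<ge> t0.\<close>
definition is_solution :: "complex ^ 'm ^ 'm \<Rightarrow> (real \<Rightarrow> complex ^ 'm) \<Rightarrow> real \<Rightarrow> bool" where
  "is_solution H zh t0 \<longleftrightarrow>
     (\<forall>t\<ge>t0. (zh has_vector_derivative (H *v zh t)) (at t within {t0..}))"

definition exp_conv :: "(real \<Rightarrow> complex ^ 'm) \<Rightarrow> real \<Rightarrow> complex ^ 'm \<Rightarrow> bool" where
  "exp_conv zh t0 zinf \<longleftrightarrow>
     (\<exists>\<tau>>0. \<exists>\<sigma>>0. \<forall>t\<ge>t0.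
        norm (zh t - zinf) \<le> \<tau> * exp (- \<sigma> * (t - t0)) * norm (zh t0 - zinf))"

text \<open>Complex span of a vector.\<close>
definition cspan1 :: "complex ^ 'm \<Rightarrow> (complex ^ 'm) set" where
  "cspan1 z = {c *s z | c. True}"

definition colspace :: "complex ^ 'm ^ 'm \<Rightarrow> (complex ^ 'm) set" where
  "colspace H = {H *v x | x. True}"

end

theory Submission
  imports Defs
begin

text \<open>
  Since theta_jk is the difference of the bearing angles of consecutive edges, the matrix H
  factors as D L D^*, where D = diag z is unitary and L is the Laplacian
  f \<mapsto> (\<lambda>k. \<Sum>j\<in>N_k. f_j - f_k) of the line graph of the edge localization graph.
  So y = D^* zh follows the consensus flow y' = L y. As the edge localization graph is
  symmetric, the random walk on its line graph is doubly stochastic: the weights 1/|N_k|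
  annihilate L from the left, the weighted sum of y is conserved, and the weighted variance of y
  decreases at the rate of the Dirichlet energy. If there is an oriented spanning tree, the line
  graph is strongly connected, the energy dominates a multiple of the variance, and y converges
  exponentially to its conserved weighted mean; the limit vanishes exactly when the conserved
  quantity does, which characterises the range of H. Without a spanning tree, the indicator of a
  reachability class of the line graph, rotated by D, is a stationary solution outside span z.
\<close>

section \<open>Exponential decay\<close>

lemma has_real_derivative_norm_diff_sq:
  fixes g :: "real \<Rightarrow> 'a::real_inner"
  assumes "(g has_vector_derivative g') (at t within s)"
  shows "((\<lambda>t. (norm (g t - c))\<^sup>2) has_real_derivative 2 * ((g t - c) \<bullet> g')) (at t within s)"
proof -
  have d: "((\<lambda>t. g t - c) has_derivative (\<lambda>h. h *\<^sub>R g')) (at t within s)"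
    using assms unfolding has_vector_derivative_def by (auto intro!: derivative_eq_intros)
  show ?thesis
    unfolding power2_norm_eq_inner has_field_derivative_def
    by (rule has_derivative_eq_rhs[OF has_derivative_inner[OF d d]])
       (simp add: fun_eq_iff inner_commute algebra_simps)
qed

lemma gronwall_exp_decay:
  fixes V V' :: "real \<Rightarrow> real"
  assumes deriv: "\<And>t. t \<ge> t0 \<Longrightarrow> (V has_real_derivative V' t) (at t within {t0..})"
    and decay: "\<And>t. t \<ge> t0 \<Longrightarrow> V' t \<le> - \<mu> * V t" and t: "t \<ge> t0"
  shows "V t \<le> exp (- \<mu> * (t - t0)) * V t0"
proof -
  define g where "g t = exp (\<mu> * (t - t0)) * V t" for t
  define g' where "g' t = exp (\<mu> * (t - t0)) * (\<mu> * V t + V' t)" for t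
  have "(g has_derivative (\<lambda>h. h * g' x)) (at x within {t0..t})" if "t0 \<le> x" "x \<le> t" for x
  proof -
    have "(g has_real_derivative g' x) (at x within {t0..})"
      unfolding g_def[abs_def] g'_def
      using that by (auto intro!: derivative_eq_intros deriv simp: algebra_simps)
    then show ?thesis
      unfolding has_field_derivative_def
      by (rule has_derivative_subset[THEN has_derivative_eq_rhs]) (auto simp: fun_eq_iff)
  qed
  from mvt_very_simple[OF t this]
  obtain x where x: "x \<in> {t0..t}" and gx: "g t - g t0 = (t - t0) * g' x" by auto
  have "g' x \<le> 0"
    using decay[of x] x unfolding g'_def by (simp add: mult_nonneg_nonpos)
  then have "(t - t0) * g' x \<le> 0"
    using t by (simp add: mult_nonneg_nonpos)
  then have "g t \<le> g t0" using gx by simp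
  then have "exp (- \<mu> * (t - t0)) * g t \<le> exp (- \<mu> * (t - t0)) * V t0"
    unfolding g_def by simp
  then show ?thesis unfolding g_def by (simp add: mult.assoc[symmetric] exp_add[symmetric])
qed

lemma exp_decay_bound_imp_nonpos:
  fixes a A \<sigma> :: real
  assumes "\<sigma> > 0" and "\<forall>t\<ge>t0. a \<le> A * exp (- \<sigma> * (t - t0))"
  shows "a \<le> 0"
proof (rule tendsto_lowerbound)
  have "LIM t at_top. \<sigma> * (- t0 + t) :> at_top"
    by (rule filterlim_tendsto_pos_mult_at_top[OF tendsto_const \<open>\<sigma> > 0\<close>
          filterlim_tendsto_add_at_top[OF tendsto_const filterlim_ident]])
  then have "LIM t at_top. - \<sigma> * (t - t0) :> at_bot"
    by (simp add: filterlim_uminus_at_bot algebra_simps)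
  then show "((\<lambda>t. A * exp (- \<sigma> * (t - t0))) \<longlongrightarrow> 0) at_top"
    by (intro tendsto_mult_right_zero filterlim_compose[OF exp_at_bot])
  show "\<forall>\<^sub>F t in at_top. a \<le> A * exp (- \<sigma> * (t - t0))"
    using eventually_ge_at_top[of t0] by eventually_elim (use assms(2) in auto)
qed simp

lemma exp_conv_const_imp_eq:
  assumes "exp_conv (\<lambda>t. x) t0 zinf"
  shows "x = zinf"
proof -
  from assms obtain \<tau> \<sigma> where "\<sigma> > 0"
    and "\<forall>t\<ge>t0. norm (x - zinf) \<le> (\<tau> * norm (x - zinf)) * exp (- \<sigma> * (t - t0))"
    unfolding exp_conv_def by (auto simp: algebra_simps)
  then have "norm (x - zinf) \<le> 0" by (rule exp_decay_bound_imp_nonpos)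
  then show ?thesis by simp
qed

lemma exp_conv_preserves_invariant:
  assumes "bounded_linear f" and invariant: "\<And>t. t \<ge> t0 \<Longrightarrow> f (zh t) = f (zh t0)"
    and "exp_conv zh t0 zinf"
  shows "f zinf = f (zh t0)"
proof -
  from \<open>exp_conv zh t0 zinf\<close> obtain \<tau> \<sigma> where "\<sigma> > 0" and conv:
    "\<And>t. t \<ge> t0 \<Longrightarrow> norm (zh t - zinf) \<le> \<tau> * exp (- \<sigma> * (t - t0)) * norm (zh t0 - zinf)"
    unfolding exp_conv_def by blast
  obtain B where B: "B > 0" "\<And>v. norm (f v) \<le> norm v * B"
    using bounded_linear.pos_bounded[OF \<open>bounded_linear f\<close>] by blast
  have "\<forall>t\<ge>t0. norm (f (zh t0) - f zinf) \<le> (\<tau> * norm (zh t0 - zinf) * B) * exp (- \<sigma> * (t - t0))"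
  proof (intro allI impI)
    fix t :: real assume t: "t \<ge> t0"
    have "norm (f (zh t0) - f zinf) = norm (f (zh t - zinf))"
      using invariant[OF t] linear_diff[OF bounded_linear.linear[OF \<open>bounded_linear f\<close>]] by simp
    also have "\<dots> \<le> norm (zh t - zinf) * B" by (rule B(2))
    also have "\<dots> \<le> (\<tau> * exp (- \<sigma> * (t - t0)) * norm (zh t0 - zinf)) * B"
      using conv[OF t] B(1) by (intro mult_right_mono) auto
    finally show "norm (f (zh t0) - f zinf) \<le> (\<tau> * norm (zh t0 - zinf) * B) * exp (- \<sigma> * (t - t0))"
      by (simp add: algebra_simps)
  qed
  with \<open>\<sigma> > 0\<close> have "norm (f (zh t0) - f zinf) \<le> 0"
    by (rule exp_decay_bound_imp_nonpos)
  then show ?thesis by simp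
qed

section \<open>Consensus flow of a doubly stochastic random walk\<close>

text \<open>in_weight_sum says that the transition matrix of the walk stepping from k to a uniformly
  chosen element of nb k has column sums 1, i.e. is doubly stochastic.\<close>

locale doubly_stochastic_walk =
  fixes nb :: "'m::finite \<Rightarrow> 'm set"
  assumes nb_nonempty: "nb k \<noteq> {}"
    and in_weight_sum: "(\<Sum>k | j \<in> nb k. 1 / real (card (nb k))) = 1"
begin

definition weight :: "'m \<Rightarrow> real" where
  "weight k = 1 / real (card (nb k))"

definition laplacian :: "('m \<Rightarrow> 'a::ab_group_add) \<Rightarrow> 'm \<Rightarrow> 'a" where
  "laplacian f k = (\<Sum>j\<in>nb k. f j - f k)"

definition energy :: "('m \<Rightarrow> 'a::real_normed_vector) \<Rightarrow> real" where
  "energy f = (\<Sum>k\<in>UNIV. weight k * (\<Sum>j\<in>nb k. (norm (f j - f k))\<^sup>2))"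

definition weighted_sum :: "('m \<Rightarrow> 'a::real_vector) \<Rightarrow> 'a" where
  "weighted_sum f = (\<Sum>k\<in>UNIV. weight k *\<^sub>R f k)"

definition weighted_mean :: "('m \<Rightarrow> 'a::real_vector) \<Rightarrow> 'a" where
  "weighted_mean f = weighted_sum f /\<^sub>R (\<Sum>k\<in>UNIV. weight k)"

definition variance :: "('m \<Rightarrow> 'a::real_normed_vector) \<Rightarrow> 'a \<Rightarrow> real" where
  "variance f c = (\<Sum>k\<in>UNIV. weight k * (norm (f k - c))\<^sup>2)"

definition laplacian_flow :: "(real \<Rightarrow> 'm \<Rightarrow> 'a::real_normed_vector) \<Rightarrow> real \<Rightarrow> bool" where
  "laplacian_flow y t0 \<longleftrightarrow>
     (\<forall>t\<ge>t0. \<forall>k. ((\<lambda>t. y t k) has_vector_derivative laplacian (y t) k) (at t within {t0..}))"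

definition arcs :: "('m \<times> 'm) set" where
  "arcs = {(k, j). j \<in> nb k}"

lemma card_nb_pos: "card (nb k) > 0"
  using nb_nonempty[of k] card_gt_0_iff finite by blast

lemma weight_pos: "weight k > 0"
  unfolding weight_def using card_nb_pos[of k] by (simp del: card_gt_0_iff)

lemma card_nb_mult_weight: "real (card (nb k)) * weight k = 1"
  unfolding weight_def by (simp add: nb_nonempty)

lemma weight_le_1: "weight k \<le> 1"
  unfolding weight_def using card_nb_pos[of k] by simp

lemma weight_ge_inverse_card: "1 / real CARD('m) \<le> weight k"
  unfolding weight_def using card_nb_pos[of k] by (simp add: frac_le card_mono)

lemma sum_weight_pos: "(\<Sum>k\<in>UNIV. weight k) > 0"
  using weight_pos by (intro sum_pos) auto

lemma sum_weight_scaleR_sum_nb: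
  fixes f :: "'m \<Rightarrow> 'a::real_vector"
  shows "(\<Sum>k\<in>UNIV. weight k *\<^sub>R (\<Sum>j\<in>nb k. f j)) = (\<Sum>j\<in>UNIV. f j)"
proof -
  have "(\<Sum>k\<in>UNIV. weight k *\<^sub>R (\<Sum>j\<in>nb k. f j))
        = (\<Sum>k\<in>UNIV. \<Sum>j\<in>UNIV. if j \<in> nb k then weight k *\<^sub>R f j else 0)"
    by (simp add: scaleR_sum_right sum.If_cases)
  also have "\<dots> = (\<Sum>j\<in>UNIV. \<Sum>k\<in>UNIV. if j \<in> nb k then weight k *\<^sub>R f j else 0)"
    by (rule sum.swap)
  also have "\<dots> = (\<Sum>j\<in>UNIV. (\<Sum>k | j \<in> nb k. weight k) *\<^sub>R f j)"
    by (simp add: scaleR_sum_left sum.If_cases)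
  also have "\<dots> = (\<Sum>j\<in>UNIV. f j)"
    using in_weight_sum by (simp add: weight_def)
  finally show ?thesis .
qed

lemma weighted_sum_laplacian: "weighted_sum (laplacian f) = 0"
proof -
  have "laplacian f k = (\<Sum>j\<in>nb k. f j) - real (card (nb k)) *\<^sub>R f k" for k
    unfolding laplacian_def by (simp add: sum_subtractf sum_constant_scaleR)
  then have "weighted_sum (laplacian f) = (\<Sum>k\<in>UNIV. weight k *\<^sub>R (\<Sum>j\<in>nb k. f j))
                      - (\<Sum>k\<in>UNIV. (real (card (nb k)) * weight k) *\<^sub>R f k)"
    unfolding weighted_sum_def by (simp add: sum_subtractf scaleR_diff_right mult.commute)
  then show ?thesis unfolding sum_weight_scaleR_sum_nb card_nb_mult_weight by simp
qed

lemma weighted_sum_const: "weighted_sum (\<lambda>_. c) = (\<Sum>k\<in>UNIV. weight k) *\<^sub>R c"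
  unfolding weighted_sum_def by (simp add: scaleR_sum_left)

lemma energy_nonneg: "energy f \<ge> 0"
  unfolding energy_def by (auto intro!: sum_nonneg mult_nonneg_nonneg less_imp_le[OF weight_pos])

lemma laplacian_diff_const: "laplacian (\<lambda>j. f j - c) = laplacian f"
  unfolding laplacian_def by simp

lemma energy_diff_const: "energy (\<lambda>j. f j - c) = energy f"
  unfolding energy_def by simp

lemma sum_weight_inner_laplacian:
  fixes f :: "'m \<Rightarrow> 'a::real_inner"
  shows "(\<Sum>k\<in>UNIV. weight k * (2 * (f k \<bullet> laplacian f k))) = - energy f"
proof -
  have polar: "2 * (a \<bullet> (b - a)) = (norm b)\<^sup>2 - (norm a)\<^sup>2 - (norm (b - a))\<^sup>2" for a b :: 'a
    by (simp add: power2_norm_eq_inner inner_diff_left inner_diff_right inner_commute)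
  have "(\<Sum>k\<in>UNIV. weight k * (2 * (f k \<bullet> laplacian f k)))
      = (\<Sum>k\<in>UNIV. weight k * (\<Sum>j\<in>nb k. (norm (f j))\<^sup>2 - (norm (f k))\<^sup>2 - (norm (f j - f k))\<^sup>2))"
    unfolding laplacian_def inner_sum_right sum_distrib_left polar ..
  also have "\<dots> = (\<Sum>k\<in>UNIV. weight k *\<^sub>R (\<Sum>j\<in>nb k. (norm (f j))\<^sup>2))
       - (\<Sum>k\<in>UNIV. (real (card (nb k)) * weight k) * (norm (f k))\<^sup>2) - energy f"
    unfolding energy_def by (simp add: sum_subtractf sum_distrib_left sum.distrib algebra_simps)
  also have "\<dots> = - energy f"
    unfolding sum_weight_scaleR_sum_nb card_nb_mult_weight by simp
  finally show ?thesis .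
qed

lemma norm_diff_sq_le_energy:
  assumes "j \<in> nb k"
  shows "(norm (f j - f k))\<^sup>2 \<le> real CARD('m) * energy f"
proof -
  have "weight k * (norm (f j - f k))\<^sup>2 \<le> weight k * (\<Sum>j\<in>nb k. (norm (f j - f k))\<^sup>2)"
    using assms weight_pos[of k] by (intro mult_left_mono member_le_sum) auto
  also have "\<dots> \<le> energy f"
    unfolding energy_def
    by (intro member_le_sum[of k UNIV "\<lambda>k. weight k * (\<Sum>j\<in>nb k. (norm (f j - f k))\<^sup>2)"])
       (auto intro!: mult_nonneg_nonneg sum_nonneg less_imp_le[OF weight_pos])
  finally have "weight k * (norm (f j - f k))\<^sup>2 \<le> energy f" .
  then have "(norm (f j - f k))\<^sup>2 \<le> real (card (nb k)) * energy f"
    using card_nb_mult_weight[of k] mult_left_mono[of _ _ "real (card (nb k))"]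
    by (fastforce simp: mult.assoc[symmetric])
  also have "\<dots> \<le> real CARD('m) * energy f"
    using energy_nonneg[of f] by (intro mult_right_mono) (auto simp: card_mono)
  finally show ?thesis .
qed

lemma norm_diff_le_if_relpow:
  assumes "(k, l) \<in> arcs ^^ n"
  shows "norm (f k - f l) \<le> n * sqrt (real CARD('m) * energy f)"
  using assms
proof (induction n arbitrary: l)
  case 0
  then show ?case by simp
next
  case (Suc n)
  then obtain l' where l': "(k, l') \<in> arcs ^^ n" "l \<in> nb l'"
    unfolding arcs_def by auto
  have "norm (f k - f l) \<le> norm (f k - f l') + norm (f l - f l')"
    using norm_triangle_ineq[of "f k - f l'" "f l' - f l"] by (simp add: norm_minus_commute)
  also have "\<dots> \<le> n * sqrt (real CARD('m) * energy f) + sqrt (real CARD('m) * energy f)"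
    using Suc.IH[OF l'(1)] norm_diff_sq_le_energy[OF l'(2), of f]
    by (intro add_mono) (auto simp: real_le_rsqrt)
  finally show ?case by (simp add: algebra_simps)
qed

lemma laplacian_reachable_indicator:
  assumes reversible: "\<And>k j. (k, j) \<in> arcs \<Longrightarrow> (j, k) \<in> arcs\<^sup>*"
  shows "laplacian (\<lambda>j. if (k0, j) \<in> arcs\<^sup>* then a else 0) k = 0"
proof -
  have "(k0, j) \<in> arcs\<^sup>* \<longleftrightarrow> (k0, k) \<in> arcs\<^sup>*" if "j \<in> nb k" for j
    using that reversible[of k j] unfolding arcs_def
    by (blast intro: rtrancl_into_rtrancl rtrancl_trans)
  then show ?thesis unfolding laplacian_def by (intro sum.neutral) auto
qed

lemma weighted_sum_laplacian_flow_const: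
  assumes "laplacian_flow y t0" and "t \<ge> t0"
  shows "weighted_sum (y t) = weighted_sum (y t0)"
proof -
  have "((\<lambda>t. weighted_sum (y t)) has_vector_derivative 0) (at s within {t0..})"
    if "s \<in> {t0..}" for s
  proof -
    have "((\<lambda>t. weighted_sum (y t)) has_vector_derivative weighted_sum (laplacian (y s)))
            (at s within {t0..})"
      using assms(1) that unfolding weighted_sum_def laplacian_flow_def
      by (auto intro!: derivative_eq_intros)
    then show ?thesis by (simp add: weighted_sum_laplacian)
  qed
  from has_vector_derivative_zero_constant[OF convex_real_interval(1) this]
  obtain c where "\<And>s. s \<in> {t0..} \<Longrightarrow> weighted_sum (y s) = c" by blast
  with \<open>t \<ge> t0\<close> show ?thesis by simp
qed

lemma laplacian_flow_has_derivative_variance: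
  fixes y :: "real \<Rightarrow> 'm \<Rightarrow> 'a::real_inner"
  assumes "laplacian_flow y t0" and "t \<ge> t0"
  shows "((\<lambda>t. variance (y t) c) has_real_derivative - energy (y t)) (at t within {t0..})"
proof -
  have "((\<lambda>t. variance (y t) c) has_real_derivative
          (\<Sum>k\<in>UNIV. weight k * (2 * ((y t k - c) \<bullet> laplacian (y t) k)))) (at t within {t0..})"
    using assms unfolding variance_def laplacian_flow_def
    by (intro DERIV_sum DERIV_cmult has_real_derivative_norm_diff_sq) auto
  also have "(\<Sum>k\<in>UNIV. weight k * (2 * ((y t k - c) \<bullet> laplacian (y t) k))) = - energy (y t)"
    using sum_weight_inner_laplacian[of "\<lambda>k. y t k - c"]
    by (simp add: laplacian_diff_const energy_diff_const)
  finally show ?thesis .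
qed

lemma variance_le_L2_set_sq: "variance f c \<le> (L2_set (\<lambda>k. norm (f k - c)) UNIV)\<^sup>2"
  unfolding variance_def L2_set_def using weight_le_1 weight_pos
  by (simp add: sum_nonneg) (intro sum_mono mult_left_le_one_le; auto intro: less_imp_le)

lemma L2_set_sq_le_variance:
  "(L2_set (\<lambda>k. norm (f k - c)) UNIV)\<^sup>2 \<le> real CARD('m) * variance f c"
proof -
  have "(L2_set (\<lambda>k. norm (f k - c)) UNIV)\<^sup>2
          \<le> (\<Sum>k\<in>UNIV. (real CARD('m) * weight k) * (norm (f k - c))\<^sup>2)"
    unfolding L2_set_def using weight_ge_inverse_card
    by (simp add: sum_nonneg)
       (intro sum_mono mult_le_cancel_right1[THEN iffD2] impI; simp add: field_simps)
  then show ?thesis unfolding variance_def by (simp add: sum_distrib_left mult.assoc)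
qed

end

locale strongly_connected_walk = doubly_stochastic_walk nb for nb :: "'m::finite \<Rightarrow> 'm set" +
  assumes strongly_connected: "(k, l) \<in> arcs\<^sup>*"
begin

lemma norm_diff_le_sqrt_energy:
  "norm (f k - f l) \<le> card arcs * sqrt (real CARD('m) * energy f)"
proof -
  have "finite arcs" by simp
  from strongly_connected[of k l] rtrancl_finite_eq_relpow[OF this]
  obtain n where "n \<le> card arcs" "(k, l) \<in> arcs ^^ n" by auto
  then have "norm (f k - f l) \<le> n * sqrt (real CARD('m) * energy f)"
    by (intro norm_diff_le_if_relpow)
  also have "\<dots> \<le> card arcs * sqrt (real CARD('m) * energy f)"
    using \<open>n \<le> card arcs\<close> energy_nonneg[of f] by (intro mult_right_mono) auto
  finally show ?thesis .
qed

lemma laplacian_eq_0_imp_const: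
  fixes f :: "'m \<Rightarrow> 'a::real_inner"
  assumes "\<And>k. laplacian f k = 0"
  shows "f k = f l"
proof -
  have "energy f = 0"
    using sum_weight_inner_laplacian[of f] assms by simp
  then show ?thesis
    using norm_diff_le_sqrt_energy[of f k l] by simp
qed

lemma variance_le_energy:
  "variance f (weighted_mean f) \<le> (\<Sum>k\<in>UNIV. weight k) * (card arcs)\<^sup>2 * real CARD('m) * energy f"
proof -
  define W where "W = (\<Sum>k\<in>UNIV. weight k)"
  define B where "B = card arcs * sqrt (real CARD('m) * energy f)"
  have "norm (f k - weighted_mean f) \<le> B" for k
  proof -
    have "f k - weighted_mean f = (\<Sum>l\<in>UNIV. weight l *\<^sub>R (f k - f l)) /\<^sub>R W"
      using sum_weight_pos unfolding weighted_mean_def weighted_sum_def W_def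
      by (simp add: scaleR_diff_right sum_subtractf scaleR_sum_left[symmetric] algebra_simps)
    also have "norm \<dots> \<le> (\<Sum>l\<in>UNIV. weight l * B) / W"
    proof -
      have "norm (\<Sum>l\<in>UNIV. weight l *\<^sub>R (f k - f l)) \<le> (\<Sum>l\<in>UNIV. weight l * B)"
        using weight_pos norm_diff_le_sqrt_energy[of f k] unfolding B_def
        by (intro order_trans[OF norm_sum] sum_mono) (simp add: less_imp_le mult_left_mono)
      then show ?thesis
        using sum_weight_pos unfolding W_def by (simp add: divide_right_mono field_simps)
    qed
    also have "\<dots> = B"
      using sum_weight_pos unfolding W_def by (simp add: sum_distrib_right[symmetric])
    finally show ?thesis .
  qed
  then have "(norm (f k - weighted_mean f))\<^sup>2 \<le> B\<^sup>2" for k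
    by (intro power_mono) auto
  then have "variance f (weighted_mean f) \<le> (\<Sum>k\<in>UNIV. weight k * B\<^sup>2)"
    unfolding variance_def using weight_pos
    by (intro sum_mono mult_left_mono) (auto intro: less_imp_le)
  also have "\<dots> = W * (card arcs)\<^sup>2 * real CARD('m) * energy f"
    using energy_nonneg[of f]
    by (simp add: W_def B_def sum_distrib_right power_mult_distrib mult.assoc)
  finally show ?thesis unfolding W_def .
qed

lemma laplacian_flow_variance_exp_decay:
  fixes y :: "real \<Rightarrow> 'm \<Rightarrow> 'a::real_inner"
  assumes flow: "laplacian_flow y t0"
  obtains \<mu> where "\<mu> > 0"
    and "\<And>t. t \<ge> t0 \<Longrightarrow> variance (y t) (weighted_mean (y t0))
                      \<le> exp (- \<mu> * (t - t0)) * variance (y t0) (weighted_mean (y t0))"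
proof
  define K where "K = (\<Sum>k\<in>UNIV. weight k) * (card arcs)\<^sup>2 * real CARD('m)"
  have "K \<ge> 0" unfolding K_def using sum_weight_pos by simp
  then show "1 / (K + 1) > 0" by simp
  fix t assume "t \<ge> t0"
  then show "variance (y t) (weighted_mean (y t0))
      \<le> exp (- (1 / (K + 1)) * (t - t0)) * variance (y t0) (weighted_mean (y t0))"
  proof (rule gronwall_exp_decay[rotated 2])
    fix s assume "s \<ge> t0"
    with flow show "((\<lambda>t. variance (y t) (weighted_mean (y t0))) has_real_derivative - energy (y s))
        (at s within {t0..})"
      by (rule laplacian_flow_has_derivative_variance)
    have "weighted_mean (y s) = weighted_mean (y t0)"
      using weighted_sum_laplacian_flow_const[OF flow \<open>s \<ge> t0\<close>] unfolding weighted_mean_def by simp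
    then have "variance (y s) (weighted_mean (y t0)) \<le> K * energy (y s)"
      using variance_le_energy[of "y s"] unfolding K_def by simp
    then have "1 / (K + 1) * variance (y s) (weighted_mean (y t0)) \<le> K / (K + 1) * energy (y s)"
      using \<open>K \<ge> 0\<close> by (simp add: divide_right_mono)
    also have "\<dots> \<le> energy (y s)"
      using \<open>K \<ge> 0\<close> energy_nonneg[of "y s"] by (intro mult_left_le_one_le) auto
    finally show "- energy (y s) \<le> - (1 / (K + 1)) * variance (y s) (weighted_mean (y t0))"
      by simp
  qed
qed

theorem laplacian_flow_exp_convergence:
  fixes y :: "real \<Rightarrow> 'm \<Rightarrow> 'a::real_inner"
  assumes "laplacian_flow y t0"
  defines "dist_mean t \<equiv> L2_set (\<lambda>k. norm (y t k - weighted_mean (y t0))) UNIV"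
  shows "\<exists>\<tau>>0. \<exists>\<sigma>>0. \<forall>t\<ge>t0. dist_mean t \<le> \<tau> * exp (- \<sigma> * (t - t0)) * dist_mean t0"
proof -
  obtain \<mu> where "\<mu> > 0" and decay: "\<And>t. t \<ge> t0 \<Longrightarrow> variance (y t) (weighted_mean (y t0))
      \<le> exp (- \<mu> * (t - t0)) * variance (y t0) (weighted_mean (y t0))"
    using laplacian_flow_variance_exp_decay[OF assms(1)] by blast
  define \<tau> where "\<tau> = sqrt (real CARD('m))"
  have "dist_mean t \<le> \<tau> * exp (- (\<mu> / 2) * (t - t0)) * dist_mean t0" if "t \<ge> t0" for t
  proof -
    have "(dist_mean t)\<^sup>2 \<le> real CARD('m) * variance (y t) (weighted_mean (y t0))"
      unfolding dist_mean_def by (rule L2_set_sq_le_variance)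
    also have "\<dots> \<le> real CARD('m) * (exp (- \<mu> * (t - t0)) * (dist_mean t0)\<^sup>2)"
    proof -
      have "variance (y t) (weighted_mean (y t0))
              \<le> exp (- \<mu> * (t - t0)) * variance (y t0) (weighted_mean (y t0))"
        by (rule decay[OF that])
      also have "\<dots> \<le> exp (- \<mu> * (t - t0)) * (dist_mean t0)\<^sup>2"
        unfolding dist_mean_def by (intro mult_left_mono variance_le_L2_set_sq) simp
      finally show ?thesis by (rule mult_left_mono) simp
    qed
    also have "\<dots> = (\<tau> * exp (- (\<mu> / 2) * (t - t0)) * dist_mean t0)\<^sup>2"
    proof -
      have "(exp (- (\<mu> / 2) * (t - t0)))\<^sup>2 = exp (- \<mu> * (t - t0))"
        by (simp add: power2_eq_square flip: exp_add)
      then show ?thesis unfolding \<tau>_def by (simp add: power_mult_distrib)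
    qed
    finally show ?thesis
      by (rule power2_le_imp_le) (simp add: \<tau>_def dist_mean_def)
  qed
  moreover have "\<tau> > 0" "\<mu> / 2 > 0" unfolding \<tau>_def using \<open>\<mu> > 0\<close> by auto
  ultimately show ?thesis by blast
qed

end

section \<open>The edge localization graph and the estimation dynamics\<close>

lemma cis_PV: "cis (PV x) = cis x"
proof -
  have "cis (PV x) = cis x * cis (2 * pi * of_int (- \<lfloor>(x + pi) / (2 * pi)\<rfloor>))"
    unfolding PV_def cis_mult by (simp add: algebra_simps)
  also have "\<dots> = cis x" by (subst cis_multiple_2pi) auto
  finally show ?thesis .
qed

lemma cis_bangle: "p v \<noteq> p u \<Longrightarrow> cis (bangle p v u) = sgn (p v - p u)"
  unfolding bangle_def bearing_def cis_PV by (simp add: cis_Arg sgn_eq sgn_zero_iff)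

lemma cis_subangle:
  "p w \<noteq> p u \<Longrightarrow> p v \<noteq> p u \<Longrightarrow> cis (subangle p u w v) = sgn (p w - p u) / sgn (p v - p u)"
  unfolding subangle_def cis_PV by (simp add: cis_bangle flip: cis_divide)

lemma inverse_eq_cnj_if_norm_1: "cmod a = 1 \<Longrightarrow> inverse a = cnj a"
  by (metis complex_norm_square inverse_unique mult.commute of_real_1 power_one)

lemma has_oriented_spanning_tree_if_reaches_root:
  assumes "r \<in> V" and "\<And>v. v \<in> V \<Longrightarrow> (v, r) \<in> E\<^sup>*"
  shows "has_oriented_spanning_tree V E"
proof -
  define d where "d v = (LEAST n. (v, r) \<in> E ^^ n)" for v
  define T where "T = {(u, v). (u, v) \<in> E \<and> d v < d u}"
  have "acyclic T"
  proof -
    have "T\<inverse> \<subseteq> inv_image less_than d" unfolding T_def by auto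
    then have "wf (T\<inverse>)" by (rule wf_subset[OF wf_inv_image[OF wf_less_than]])
    then show ?thesis using wf_acyclic acyclic_converse by blast
  qed
  moreover have "(u, r) \<in> T\<^sup>+" if "(u, r) \<in> E\<^sup>*" "u \<noteq> r" for u
    using that
  proof (induction "d u" arbitrary: u rule: less_induct)
    case less
    from rtrancl_imp_relpow[OF less.prems(1)] obtain n where "(u, r) \<in> E ^^ n" by blast
    then have du: "(u, r) \<in> E ^^ d u" unfolding d_def by (rule LeastI)
    with less.prems(2) have "d u \<noteq> 0" by (metis relpow_0_E)
    then obtain m where m: "d u = Suc m" using not0_implies_Suc by blast
    from relpow_Suc_D2[OF du[unfolded m]] obtain v where v: "(u, v) \<in> E" "(v, r) \<in> E ^^ m"
      by blast
    have "d v \<le> m" unfolding d_def using v(2) by (rule Least_le)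
    then have uv: "(u, v) \<in> T" unfolding T_def using v(1) m by auto
    show ?case
    proof (cases "v = r")
      case True
      with uv show ?thesis by blast
    next
      case False
      with less.hyps[of v] \<open>d v \<le> m\<close> m relpow_imp_rtrancl[OF v(2)] have "(v, r) \<in> T\<^sup>+"
        by auto
      with uv show ?thesis by (rule trancl_into_trancl2)
    qed
  qed
  ultimately have "is_oriented_spanning_tree V E r T"
    unfolding is_oriented_spanning_tree_def using assms by (auto simp: T_def)
  then show ?thesis unfolding has_oriented_spanning_tree_def by blast
qed

lemma commE_sym: "(u, v) \<in> commE S \<Longrightarrow> (v, u) \<in> commE S"
  unfolding commE_def by blast

lemma Ebar_sym: "(a, b) \<in> Ebar S \<Longrightarrow> (b, a) \<in> Ebar S"
  unfolding Ebar_def using commE_sym by blast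

lemma is_solution_const: "H *v x = 0 \<Longrightarrow> is_solution H (\<lambda>t. x) t0"
  unfolding is_solution_def by (auto intro: derivative_eq_intros)

locale edge_localization =
  fixes N :: nat and p :: "nat \<Rightarrow> complex" and S :: "(nat \<times> nat \<times> nat) set"
    and lab :: "'m::finite \<Rightarrow> vtx \<times> vtx"
  assumes distinct_pos: "inj_on p {1..N}"
    and S_agents: "S \<subseteq> {(u, w, v). u \<in> {1..N} \<and> w \<in> {1..N} \<and> v \<in> {1..N}
                                   \<and> u \<noteq> w \<and> u \<noteq> v \<and> w \<noteq> v}"
    and S_sym: "\<forall>u w v. (u, w, v) \<in> S \<longleftrightarrow> (u, v, w) \<in> S"
    and lab_bij: "bij_betw lab UNIV (Ebar S)"
begin

abbreviation z :: "complex ^ 'm" where "z \<equiv> zvec p lab"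

abbreviation H :: "complex ^ 'm ^ 'm" where "H \<equiv> Hmat p lab"

lemma commE_agents: "(u, v) \<in> commE S \<Longrightarrow> u \<noteq> v \<and> u \<in> {1..N} \<and> v \<in> {1..N}"
  using S_agents unfolding commE_def by blast

lemma Ebar_agents:
  assumes "(a, b) \<in> Ebar S"
  shows "rho a \<noteq> rho b \<and> rho a \<in> {1..N} \<and> rho b \<in> {1..N}"
proof -
  from assms obtain u v where "(u, v) \<in> commE S" and
    "(a, b) = (Ag u, Ag v) \<or> (a, b) = (Ag u, Vir u v) \<or> (a, b) = (Vir u v, Ag u)"
    unfolding Ebar_def by blast
  then show ?thesis using commE_agents[of u v] by auto
qed

lemma Ebar_subset_Vbar: "(a, b) \<in> Ebar S \<Longrightarrow> a \<in> Vbar S \<and> b \<in> Vbar S"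
proof -
  have "measures S u" if "(u, v) \<in> commE S" "\<not> meas_with S v u" for u v
    using that S_sym unfolding commE_def measures_def meas_with_def by blast
  then show "(a, b) \<in> Ebar S \<Longrightarrow> a \<in> Vbar S \<and> b \<in> Vbar S"
    unfolding Ebar_def Vbar_def by (auto simp: meas_with_def measures_def)
qed

lemma Vbar_has_in_edge: "v \<in> Vbar S \<Longrightarrow> \<exists>a. (a, v) \<in> Ebar S"
proof -
  assume "v \<in> Vbar S"
  then consider (agent) x w u where "v = Ag x" "(x, w, u) \<in> S"
    | (virtual) u x where "v = Vir u x" "(u, x) \<in> commE S" "\<not> meas_with S x u"
    unfolding Vbar_def measures_def by blast
  then show ?thesis
  proof cases
    case agent
    then have "(u, x) \<in> commE S" "meas_with S x u"
      unfolding commE_def meas_with_def by blast+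
    then show ?thesis
      using agent(1) commE_sym unfolding Ebar_def by (cases "meas_with S u x") blast+
  qed (auto simp: Ebar_def)
qed

lemma lab_in_Ebar: "lab k \<in> Ebar S"
  using lab_bij bij_betwE by blast

lemma lab_surj: "e \<in> Ebar S \<Longrightarrow> \<exists>k. lab k = e"
  using lab_bij unfolding bij_betw_def by (metis UNIV_I image_iff)

definition reversal :: "'m \<Rightarrow> 'm" where
  "reversal k = inv lab (prod.swap (lab k))"

lemma lab_reversal: "lab (reversal k) = prod.swap (lab k)"
proof -
  have "prod.swap (lab k) \<in> range lab"
    using lab_bij lab_in_Ebar[of k] Ebar_sym
    unfolding bij_betw_def by (metis prod.collapse swap_simp)
  then show ?thesis unfolding reversal_def by (rule f_inv_into_f)
qed

lemma reversal_in_nbrs: "reversal k \<in> nbrs lab k"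
  unfolding nbrs_def by (simp add: lab_reversal)

lemma card_in_eq_card_out: "card {k. snd (lab k) = b} = card {j. fst (lab j) = b}"
  by (rule bij_betw_same_card[of reversal], rule bij_betw_byWitness[of _ reversal])
     (auto simp: lab_reversal bij_betw_imp_inj_on[OF lab_bij] inj_eq
           intro: bij_betw_imp_inj_on[OF lab_bij, THEN injD])

text \<open>The k with j \<in> nbrs lab k are the edges entering the tail b of j, and each of them has the
  edges leaving b as neighbours; as Ebar is symmetric, b has as many entering as leaving edges.\<close>

sublocale doubly_stochastic_walk "nbrs lab"
proof
  show "nbrs lab k \<noteq> {}" for k
    using reversal_in_nbrs by blast
  fix j
  define b where "b = fst (lab j)"
  have "(\<Sum>k | j \<in> nbrs lab k. 1 / real (card (nbrs lab k)))
      = (\<Sum>k | snd (lab k) = b. 1 / real (card {j'. fst (lab j') = b}))"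
    by (rule sum.cong) (auto simp: nbrs_def b_def)
  then have "(\<Sum>k | j \<in> nbrs lab k. 1 / real (card (nbrs lab k)))
      = real (card {k. snd (lab k) = b}) / real (card {j'. fst (lab j') = b})"
    by simp
  moreover have "card {j'. fst (lab j') = b} > 0"
    unfolding b_def by (auto simp: card_gt_0_iff)
  ultimately show "(\<Sum>k | j \<in> nbrs lab k. 1 / real (card (nbrs lab k))) = 1"
    by (simp only: card_in_eq_card_out) (auto simp: b_def)
qed

lemma distinct_endpoint_positions: "p (rho (snd (lab k))) \<noteq> p (rho (fst (lab k)))"
  using Ebar_agents[of "fst (lab k)" "snd (lab k)"] lab_in_Ebar[of k] inj_onD[OF distinct_pos]
  by fastforce

lemma z_nth: "z $ k = sgn (p (rho (snd (lab k))) - p (rho (fst (lab k))))"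
  unfolding zvec_def theta_def using distinct_endpoint_positions by (simp add: cis_bangle)

lemma norm_z_nth: "cmod (z $ k) = 1"
  unfolding z_nth using distinct_endpoint_positions by (simp add: norm_sgn)

lemma z_nth_mult_cnj: "z $ k * cnj (z $ k) = 1"
  using norm_z_nth[of k] by (simp add: complex_norm_square[symmetric])

lemma cis_neg_theta_rel:
  assumes "j \<in> nbrs lab k"
  shows "cis (- theta_rel p lab j k) = z $ k * cnj (z $ j)"
proof -
  define u v w where "u = rho (fst (lab k))" and "v = rho (snd (lab k))" and "w = rho (snd (lab j))"
  have v_fst: "v = rho (fst (lab j))" using assms unfolding v_def nbrs_def by simp
  then have zk: "z $ k = sgn (p v - p u)" and zj: "z $ j = sgn (p w - p v)"
    unfolding z_nth u_def v_def w_def by simp_all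
  have "p v \<noteq> p u" "p w \<noteq> p v"
    using distinct_endpoint_positions[of k] distinct_endpoint_positions[of j] v_fst unfolding u_def v_def w_def by auto
  show ?thesis
  proof (cases "w = u")
    case True
    \<comment> \<open>j is the reversal of k, and the convention theta_jk = -pi matches z_j = -z_k\<close>
    then have "z $ j = - z $ k"
      unfolding zk zj by (metis minus_diff_eq sgn_minus)
    moreover have "theta_rel p lab j k = - pi"
      using True unfolding theta_rel_def Let_def u_def v_def w_def by simp
    ultimately show ?thesis using z_nth_mult_cnj[of k] by simp
  next
    case False
    then have "cis (theta_rel p lab j k) = - cis (subangle p v w u)"
      unfolding theta_rel_def Let_def u_def v_def w_def by (simp add: cis_PV flip: cis_mult)
    also have "\<dots> = z $ j / z $ k"
    proof -
      have "sgn (p u - p v) = - sgn (p v - p u)" by (metis minus_diff_eq sgn_minus)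
      with \<open>p v \<noteq> p u\<close> \<open>p w \<noteq> p v\<close> show ?thesis
        unfolding zk zj by (simp add: cis_subangle)
    qed
    also have "\<dots> = z $ j * cnj (z $ k)"
      by (simp add: divide_inverse inverse_eq_cnj_if_norm_1 norm_z_nth)
    finally show ?thesis by (simp flip: cis_cnj)
  qed
qed

text \<open>With D = diag z, derotate is D^* and rotate is D, so Hmat_mult below reads H = D L D^*.\<close>

definition derotate :: "complex ^ 'm \<Rightarrow> 'm \<Rightarrow> complex" where
  "derotate x k = cnj (z $ k) * x $ k"

definition rotate :: "('m \<Rightarrow> complex) \<Rightarrow> complex ^ 'm" where
  "rotate f = (\<chi> k. z $ k * f k)"

lemma rotate_derotate [simp]: "rotate (derotate x) = x"
  unfolding rotate_def derotate_def by (simp add: vec_eq_iff mult.assoc[symmetric] z_nth_mult_cnj)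

lemma derotate_rotate [simp]: "derotate (rotate f) = f"
  unfolding rotate_def derotate_def
  by (simp add: fun_eq_iff mult.assoc[symmetric] z_nth_mult_cnj mult.commute[of "cnj _"])

lemma rotate_const: "rotate (\<lambda>_. c) = c *s z"
  unfolding rotate_def by (simp add: vec_eq_iff mult.commute)

lemma rotate_diff: "rotate (\<lambda>k. f k - g k) = rotate f - rotate g"
  unfolding rotate_def by (simp add: vec_eq_iff algebra_simps)

lemma norm_rotate: "norm (rotate f) = L2_set (\<lambda>k. cmod (f k)) UNIV"
  unfolding norm_vec_def rotate_def by (simp add: norm_mult norm_z_nth)

lemma cspan1_iff_derotate_const: "x \<in> cspan1 z \<longleftrightarrow> (\<exists>c. derotate x = (\<lambda>_. c))"
proof -
  have "x = rotate (\<lambda>_. c) \<longleftrightarrow> derotate x = (\<lambda>_. c)" for c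
    by (metis derotate_rotate rotate_derotate)
  then show ?thesis unfolding cspan1_def by (simp flip: rotate_const)
qed

lemma Hmat_mult: "H *v x = rotate (laplacian (derotate x))"
proof -
  have "(H *v x) $ k = - of_nat (card (nbrs lab k)) * x $ k
          + (\<Sum>j\<in>nbrs lab k. z $ k * cnj (z $ j) * x $ j)" for k
  proof -
    have "k \<notin> nbrs lab k"
      using distinct_endpoint_positions[of k] unfolding nbrs_def by auto
    then have "(H *v x) $ k = (\<Sum>j\<in>UNIV. (if j = k then - of_nat (card (nbrs lab k)) * x $ k else 0)
              + (if j \<in> nbrs lab k then cis (- theta_rel p lab j k) * x $ j else 0))"
      unfolding matrix_vector_mult_def Hmat_def by (auto intro!: sum.cong)
    then show ?thesis
      by (simp add: sum.distrib sum.If_cases cis_neg_theta_rel)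
  qed
  moreover have "rotate (laplacian (derotate x)) $ k = - of_nat (card (nbrs lab k)) * x $ k
          + (\<Sum>j\<in>nbrs lab k. z $ k * cnj (z $ j) * x $ j)" for k
  proof -
    have "z $ k * (cnj (z $ k) * x $ k) = x $ k"
      using z_nth_mult_cnj[of k] by (simp flip: mult.assoc)
    then show ?thesis
      using z_nth_mult_cnj[of k]
      by (simp add: rotate_def laplacian_def derotate_def sum_subtractf sum_distrib_left
          algebra_simps)
  qed
  ultimately show ?thesis by (simp add: vec_eq_iff)
qed

lemma arcs_iff: "(k, j) \<in> arcs \<longleftrightarrow> fst (lab j) = snd (lab k)"
  unfolding arcs_def nbrs_def by simp

lemma arc_reversible: "(k, j) \<in> arcs \<Longrightarrow> (j, k) \<in> arcs\<^sup>*"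
proof -
  assume "(k, j) \<in> arcs"
  then have "(j, reversal j) \<in> arcs" "(reversal j, reversal k) \<in> arcs" "(reversal k, k) \<in> arcs"
    by (auto simp: arcs_iff lab_reversal)
  then show ?thesis by (meson rtrancl.rtrancl_into_rtrancl r_into_rtrancl)
qed

lemma arcs_rtrancl_imp_Ebar_rtrancl:
  "(k, l) \<in> arcs\<^sup>* \<Longrightarrow> (snd (lab k), snd (lab l)) \<in> (Ebar S)\<^sup>*"
proof (induction rule: rtrancl_induct)
  case (step j l)
  then have "(snd (lab j), snd (lab l)) \<in> Ebar S"
    using lab_in_Ebar[of l] by (metis arcs_iff prod.collapse)
  with step.IH show ?case by (rule rtrancl_into_rtrancl)
qed simp

lemma Ebar_rtrancl_imp_arcs_rtrancl:
  "(snd (lab k), b) \<in> (Ebar S)\<^sup>* \<Longrightarrow> \<exists>l. snd (lab l) = b \<and> (k, l) \<in> arcs\<^sup>*"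
proof (induction rule: rtrancl_induct)
  case (step b c)
  then obtain l where l: "snd (lab l) = b" "(k, l) \<in> arcs\<^sup>*" by blast
  obtain j where "lab j = (b, c)" using lab_surj[OF step.hyps(2)] by blast
  with l have "snd (lab j) = c" "(k, j) \<in> arcs\<^sup>*"
    by (auto simp: arcs_iff intro: rtrancl_into_rtrancl)
  then show ?case by blast
qed blast

lemma has_oriented_spanning_tree_iff_strongly_connected:
  "has_oriented_spanning_tree (Vbar S) (Ebar S) \<longleftrightarrow> (\<forall>k l. (k, l) \<in> arcs\<^sup>*)"
proof
  assume "has_oriented_spanning_tree (Vbar S) (Ebar S)"
  then obtain r T where "T \<subseteq> Ebar S" and to_root: "\<forall>v\<in>Vbar S. v \<noteq> r \<longrightarrow> (v, r) \<in> T\<^sup>+"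
    unfolding has_oriented_spanning_tree_def is_oriented_spanning_tree_def by blast
  then have "(v, r) \<in> (Ebar S)\<^sup>*" if "v \<in> Vbar S" for v
    using that trancl_mono[of "(v, r)" T "Ebar S"] by (cases "v = r") auto
  moreover have "sym ((Ebar S)\<^sup>*)"
    by (intro sym_rtrancl symI) (rule Ebar_sym)
  ultimately have connected: "(b, c) \<in> (Ebar S)\<^sup>*" if "b \<in> Vbar S" "c \<in> Vbar S" for b c
    using that by (meson rtrancl_trans symD)
  show "\<forall>k l. (k, l) \<in> arcs\<^sup>*"
  proof (intro allI)
    fix k l
    have "(snd (lab k), fst (lab l)) \<in> (Ebar S)\<^sup>*"
      using connected Ebar_subset_Vbar lab_in_Ebar by (metis prod.collapse)
    then obtain j where "snd (lab j) = fst (lab l)" "(k, j) \<in> arcs\<^sup>*"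
      by (blast dest: Ebar_rtrancl_imp_arcs_rtrancl)
    then show "(k, l) \<in> arcs\<^sup>*" by (auto simp: arcs_iff intro: rtrancl_into_rtrancl)
  qed
next
  assume strongly_connected: "\<forall>k l. (k, l) \<in> arcs\<^sup>*"
  obtain k0 :: 'm where True by blast
  show "has_oriented_spanning_tree (Vbar S) (Ebar S)"
  proof (rule has_oriented_spanning_tree_if_reaches_root)
    show "snd (lab k0) \<in> Vbar S"
      using Ebar_subset_Vbar lab_in_Ebar[of k0] by (metis prod.collapse)
    fix v assume "v \<in> Vbar S"
    then obtain a k where "lab k = (a, v)" by (blast dest: Vbar_has_in_edge lab_surj)
    then show "(v, snd (lab k0)) \<in> (Ebar S)\<^sup>*"
      using arcs_rtrancl_imp_Ebar_rtrancl[of k k0] strongly_connected by simp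
  qed
qed

lemma strongly_connected_walk_if_tree:
  "has_oriented_spanning_tree (Vbar S) (Ebar S) \<Longrightarrow> strongly_connected_walk (nbrs lab)"
  by unfold_locales (simp add: has_oriented_spanning_tree_iff_strongly_connected)

lemma kernel_outside_span_if_no_tree:
  assumes "\<not> has_oriented_spanning_tree (Vbar S) (Ebar S)"
  obtains x where "H *v x = 0" "x \<notin> cspan1 z"
proof -
  from assms obtain k0 l0 where "(k0, l0) \<notin> arcs\<^sup>*"
    by (auto simp: has_oriented_spanning_tree_iff_strongly_connected)
  define f where "f j = (if (k0, j) \<in> arcs\<^sup>* then 1 else 0 :: complex)" for j
  have "laplacian f k = 0" for k
    unfolding f_def by (rule laplacian_reachable_indicator[OF arc_reversible])
  then have "H *v rotate f = 0"
    unfolding Hmat_mult derotate_rotate by (simp add: rotate_def vec_eq_iff)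
  moreover have "f k0 \<noteq> f l0"
    using \<open>(k0, l0) \<notin> arcs\<^sup>*\<close> unfolding f_def by simp
  then have "rotate f \<notin> cspan1 z"
    unfolding cspan1_iff_derotate_const derotate_rotate by (metis)
  ultimately show ?thesis by (rule that)
qed

lemma solution_derotate_laplacian_flow:
  assumes "is_solution H zh t0"
  shows "laplacian_flow (\<lambda>t. derotate (zh t)) t0"
  unfolding laplacian_flow_def
proof (intro allI impI)
  fix t k assume "t \<ge> t0"
  with assms have "(zh has_vector_derivative H *v zh t) (at t within {t0..})"
    unfolding is_solution_def by blast
  then have "((\<lambda>t. cnj (z $ k) * zh t $ k) has_vector_derivative cnj (z $ k) * (H *v zh t) $ k)
               (at t within {t0..})"
    by (rule bounded_linear.has_vector_derivative
          [OF bounded_linear_compose[OF bounded_linear_mult_right bounded_linear_vec_nth]])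
  then show "((\<lambda>t. derotate (zh t) k) has_vector_derivative laplacian (derotate (zh t)) k)
               (at t within {t0..})"
    unfolding Hmat_mult
    by (simp add: derotate_def[symmetric] derotate_rotate[unfolded derotate_def fun_eq_iff])
qed

lemma exp_conv_if_tree:
  assumes tree: "has_oriented_spanning_tree (Vbar S) (Ebar S)" and sol: "is_solution H zh t0"
  shows "exp_conv zh t0 (weighted_mean (derotate (zh t0)) *s z)"
proof -
  interpret strongly_connected_walk "nbrs lab"
    using tree by (rule strongly_connected_walk_if_tree)
  define c where "c = weighted_mean (derotate (zh t0))"
  have dist: "norm (zh t - c *s z) = L2_set (\<lambda>k. cmod (derotate (zh t) k - c)) UNIV" for t
  proof -
    have "zh t - c *s z = rotate (\<lambda>k. derotate (zh t) k - c)"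
      by (simp add: rotate_diff rotate_const)
    then show ?thesis by (simp add: norm_rotate)
  qed
  have "\<exists>\<tau>>0. \<exists>\<sigma>>0. \<forall>t\<ge>t0. L2_set (\<lambda>k. cmod (derotate (zh t) k - c)) UNIV
      \<le> \<tau> * exp (- \<sigma> * (t - t0)) * L2_set (\<lambda>k. cmod (derotate (zh t0) k - c)) UNIV"
    unfolding c_def
    by (rule laplacian_flow_exp_convergence[OF solution_derotate_laplacian_flow[OF sol]])
  then show ?thesis unfolding exp_conv_def dist c_def[symmetric] .
qed

lemma bounded_linear_weighted_sum_derotate: "bounded_linear (\<lambda>x. weighted_sum (derotate x))"
  unfolding weighted_sum_def derotate_def
  by (intro bounded_linear_sum bounded_linear_compose[OF bounded_linear_scaleR_right]
      bounded_linear_compose[OF bounded_linear_mult_right bounded_linear_vec_nth])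

lemma weighted_sum_derotate_Hmat: "weighted_sum (derotate (H *v x)) = 0"
  by (simp add: Hmat_mult weighted_sum_laplacian)

lemma weighted_sum_derotate_scaled_z:
  "weighted_sum (derotate (c *s z)) = of_real (\<Sum>k\<in>UNIV. weight k) * c"
  by (simp flip: rotate_const add: weighted_sum_const scaleR_conv_of_real)

lemma Hmat_kernel_in_span:
  assumes "strongly_connected_walk (nbrs lab)" and "H *v x = 0"
  shows "x \<in> cspan1 z"
proof -
  interpret strongly_connected_walk "nbrs lab" by (rule assms(1))
  have "laplacian (derotate x) = derotate (H *v x)"
    by (simp add: Hmat_mult)
  also have "\<dots> = (\<lambda>_. 0)"
    using assms(2) by (simp add: derotate_def fun_eq_iff)
  finally have "\<And>k. laplacian (derotate x) k = 0" by simp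
  then have "derotate x k = derotate x k0" for k k0
    by (rule laplacian_eq_0_imp_const)
  then have "derotate x = (\<lambda>_. derotate x k0)" for k0
    by (simp add: fun_eq_iff)
  then show ?thesis unfolding cspan1_iff_derotate_const by blast
qed

text \<open>Adding the conserved quantity along z kills the kernel span z of H, so the map is injective
  and hence onto.\<close>

lemma surj_Hmat_plus_span:
  assumes "strongly_connected_walk (nbrs lab)"
  shows "surj (\<lambda>v. H *v v + weighted_sum (derotate v) *s z)" (is "surj ?G")
proof -
  define ws where "ws v = weighted_sum (derotate v)" for v
  define W where "W = (\<Sum>k\<in>UNIV. weight k)"
  have "W > 0" unfolding W_def by (rule sum_weight_pos)
  have "linear ws"
    unfolding ws_def by (rule bounded_linear.linear[OF bounded_linear_weighted_sum_derotate])
  have "linear ((*v) H)" by (rule bounded_linear.linear[OF matrix_vector_mul_bounded_linear])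
  have "linear ?G"
  proof (rule linearI)
    fix a b :: "complex ^ 'm" and r :: real
    show "?G (a + b) = ?G a + ?G b"
      using linear_add[OF \<open>linear ws\<close>] linear_add[OF \<open>linear ((*v) H)\<close>]
      unfolding ws_def by (simp add: vector_sadd_rdistrib)
    show "?G (r *\<^sub>R a) = r *\<^sub>R ?G a"
      using linear_scale[OF \<open>linear ws\<close>] linear_scale[OF \<open>linear ((*v) H)\<close>]
      unfolding ws_def by (simp add: vec_eq_iff scaleR_right_distrib)
  qed
  moreover have "inj ?G"
    unfolding linear_injective_0[OF \<open>linear ?G\<close>]
  proof (intro allI impI)
    fix v assume that: "?G v = 0"
    have "ws (?G v) = of_real W * ws v"
      using linear_add[OF \<open>linear ws\<close>] unfolding ws_def W_def
      by (simp add: weighted_sum_derotate_Hmat weighted_sum_derotate_scaled_z)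
    with \<open>W > 0\<close> that linear_0[OF \<open>linear ws\<close>] have "ws v = 0" by simp
    with that have "H *v v = 0" unfolding ws_def by simp
    then obtain c where "v = c *s z"
      using Hmat_kernel_in_span[OF assms] unfolding cspan1_def by blast
    with \<open>ws v = 0\<close> \<open>W > 0\<close> show "v = 0"
      unfolding ws_def by (simp add: weighted_sum_derotate_scaled_z flip: W_def)
  qed
  ultimately show ?thesis by (rule linear_injective_imp_surjective) simp
qed

lemma colspace_Hmat_iff:
  assumes "strongly_connected_walk (nbrs lab)"
  shows "x \<in> colspace H \<longleftrightarrow> weighted_sum (derotate x) = 0"
proof
  assume "x \<in> colspace H"
  then show "weighted_sum (derotate x) = 0"
    unfolding colspace_def by (auto simp: weighted_sum_derotate_Hmat)
next
  assume x: "weighted_sum (derotate x) = 0"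
  from surj_Hmat_plus_span[OF assms]
  obtain v where v: "x = H *v v + weighted_sum (derotate v) *s z" by (rule surjE)
  have "of_real (\<Sum>k\<in>UNIV. weight k) * weighted_sum (derotate v) = 0"
    using x linear_add[OF bounded_linear.linear[OF bounded_linear_weighted_sum_derotate]]
    unfolding v by (simp add: weighted_sum_derotate_Hmat weighted_sum_derotate_scaled_z)
  with sum_weight_pos have "weighted_sum (derotate v) = 0" by (simp del: of_real_sum)
  with v have "x = H *v v" by simp
  then show "x \<in> colspace H" unfolding colspace_def by blast
qed

lemma exp_conv_limit_nonzero_iff:
  assumes tree: "has_oriented_spanning_tree (Vbar S) (Ebar S)" and sol: "is_solution H zh t0"
    and "zinf \<in> cspan1 z" and conv: "exp_conv zh t0 zinf"
  shows "zinf \<noteq> 0 \<longleftrightarrow> zh t0 \<notin> colspace H"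
proof -
  obtain c where c: "zinf = c *s z" using \<open>zinf \<in> cspan1 z\<close> unfolding cspan1_def by blast
  have "weighted_sum (derotate zinf) = weighted_sum (derotate (zh t0))"
    by (rule exp_conv_preserves_invariant[OF bounded_linear_weighted_sum_derotate
          weighted_sum_laplacian_flow_const[OF solution_derotate_laplacian_flow[OF sol]] conv])
  then have "of_real (\<Sum>k\<in>UNIV. weight k) * c = weighted_sum (derotate (zh t0))"
    unfolding c by (simp add: weighted_sum_derotate_scaled_z)
  moreover have "z $ k \<noteq> 0" for k
    using norm_z_nth[of k] by auto
  then have "zinf \<noteq> 0 \<longleftrightarrow> c \<noteq> 0"
    unfolding c by (auto simp: vec_eq_iff)
  ultimately have "zinf \<noteq> 0 \<longleftrightarrow> weighted_sum (derotate (zh t0)) \<noteq> 0"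
    using sum_weight_pos by (metis mult_eq_0_iff of_real_eq_0_iff less_irrefl)
  then show ?thesis
    using colspace_Hmat_iff[OF strongly_connected_walk_if_tree[OF tree]] by simp
qed

end

theorem theorem3:
  fixes N :: nat and p :: "nat \<Rightarrow> complex" and S :: "(nat \<times> nat \<times> nat) set"
    and lab :: "'m::finite \<Rightarrow> vtx \<times> vtx"
  assumes distinct_pos: "inj_on p {1..N}"
    and S_agents: "S \<subseteq> {(u, w, v). u \<in> {1..N} \<and> w \<in> {1..N} \<and> v \<in> {1..N}
                                   \<and> u \<noteq> w \<and> u \<noteq> v \<and> w \<noteq> v}"
    and S_sym: "\<forall>u w v. (u, w, v) \<in> S \<longleftrightarrow> (u, v, w) \<in> S"
    and standing: "\<forall>u. \<forall>a\<in>{x. \<exists>y. (u, x, y) \<in> S}. \<forall>b\<in>{x. \<exists>y. (u, x, y) \<in> S}.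
                      (a, b) \<in> {(x, y). (u, x, y) \<in> S}\<^sup>*"
    and connected: "\<forall>a\<in>{1..N}. \<forall>b\<in>{1..N}. (a, b) \<in> (commE S)\<^sup>*"
    and lab_bij: "bij_betw lab UNIV (Ebar S)"
  shows "((\<forall>zh t0. is_solution (Hmat p lab) zh t0 \<longrightarrow>
              (\<exists>zinf \<in> cspan1 (zvec p lab). exp_conv zh t0 zinf))
          \<longleftrightarrow> has_oriented_spanning_tree (Vbar S) (Ebar S))
       \<and> (has_oriented_spanning_tree (Vbar S) (Ebar S) \<longrightarrow>
          (\<forall>zh t0 zinf. is_solution (Hmat p lab) zh t0 \<and> zinf \<in> cspan1 (zvec p lab)
              \<and> exp_conv zh t0 zinf \<longrightarrow>
              (zinf \<in> cspan1 (zvec p lab) - {0} \<longleftrightarrow> zh t0 \<notin> colspace (Hmat p lab))))"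
proof -
  interpret edge_localization N p S lab
    using distinct_pos S_agents S_sym lab_bij by unfold_locales
  have "(\<forall>zh t0. is_solution H zh t0 \<longrightarrow> (\<exists>zinf \<in> cspan1 z. exp_conv zh t0 zinf))
        \<longleftrightarrow> has_oriented_spanning_tree (Vbar S) (Ebar S)"
  proof
    assume conv: "\<forall>zh t0. is_solution H zh t0 \<longrightarrow> (\<exists>zinf \<in> cspan1 z. exp_conv zh t0 zinf)"
    show "has_oriented_spanning_tree (Vbar S) (Ebar S)"
    proof (rule ccontr)
      assume "\<not> has_oriented_spanning_tree (Vbar S) (Ebar S)"
      then obtain x where "H *v x = 0" and "x \<notin> cspan1 z"
        by (rule kernel_outside_span_if_no_tree)
      from \<open>H *v x = 0\<close> conv obtain zinf where "zinf \<in> cspan1 z" "exp_conv (\<lambda>t. x) 0 zinf"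
        using is_solution_const by blast
      with \<open>x \<notin> cspan1 z\<close> show False by (metis exp_conv_const_imp_eq)
    qed
  next
    assume "has_oriented_spanning_tree (Vbar S) (Ebar S)"
    then show "\<forall>zh t0. is_solution H zh t0 \<longrightarrow> (\<exists>zinf \<in> cspan1 z. exp_conv zh t0 zinf)"
      using exp_conv_if_tree unfolding cspan1_def by blast
  qed
  moreover note exp_conv_limit_nonzero_iff
  ultimately show ?thesis by blast
qed

end
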